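(* Let $m\ge n\ge1$, let $A\in\mathbb{C}^{n\times m}$ have rank $n$, let $\mathcal{A}(X)=\operatorname{diag}(A^*XA)$, let $b\in\mathbb{R}^m$ and $\lambda>0$. Let $\{X^k\}_{k\ge0}$ be a sequence produced by the difference of convex functions algorithm (DCA, defined in the context) starting with $X^0=0$. Then: 1. $\{X^k\}$ is bounded. 2. $X^{k+1}-X^k\to0$ as $k\to\infty$. 3. Any nonzero limit point $\tilde{X}$ of the sequence $\{X^k\}$ is a first-order stationary point of the problem of minimizing $\varphi(X)=\tfrac12\|\mathcal{A}(X)-b\|_2^2+\lambda(\operatorname{Tr}(X)-\|X\|_F)$ subject to $X\succeq0$, meaning that there exists $\tilde{\Lambda}\in\mathbb{C}^{n\times n}$ such that the following KKT conditions hold: - Stationarity: $\mathcal{A}^*(\mathcal{A}(\tilde{X})-b)+\lambda\left(I_n-\frac{\tilde{X}}{\|\tilde{X}\|_F}\right)=\tilde{\Lambda}$; - Primal feasibility: $\tilde{X}\succeq0$; - Dual feasibility: $\tilde{\Lambda}\succeq0$; - Complementary slackness: $\langle\tilde{X},\tilde{\Lambda}\rangle=0$.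
   Context: $\mathbb{H}^{n\times n}$ is the real space of $n\times n$ complex Hermitian matrices with $\langle X,Y\rangle=\operatorname{Tr}(X^*Y)$ and Frobenius norm $\|X\|_F=\sqrt{\langle X,X\rangle}$; $X\succeq0$ means $X$ is Hermitian positive semidefinite. The operator $\mathcal{A}:\mathbb{H}^{n\times n}\to\mathbb{R}^m$, $\mathcal{A}(X)=\operatorname{diag}(A^*XA)$, has adjoint $\mathcal{A}^*(x)=A\operatorname{Diag}(x)A^*$, where $\operatorname{Diag}(x)$ is the diagonal matrix with diagonal $x$. DCA iteration: given $X^k$, $X^{k+1}$ is a solution (global minimizer) of $$\min_{X\in\mathbb{C}^{n\times n}}\ \tfrac12\|\mathcal{A}(X)-b\|_2^2+\lambda\operatorname{Tr}(X)\quad\text{s.t.}\quad X\succeq0$$ if $X^k=0$, and a solution of $$\min_{X\in\mathbb{C}^{n\times n}}\ \tfrac12\|\mathcal{A}(X)-b\|_2^2+\lambda\left\langle X,\,I_n-\frac{X^k}{\|X^k\|_F}\right\rangle\quad\text{s.t.}\quad X\succeq0$$ otherwise. *)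

theory Defs
  imports "HOL-Analysis.Analysis"
begin

text \<open>An \<open>n \<times> m\<close> complex matrix is an element of \<open>complex ^ 'm ^ 'n\<close>, with
  \<open>n = CARD('n)\<close> rows and \<open>m = CARD('m)\<close> columns.\<close>

definition ctranspose :: "complex ^ 'm ^ 'n \<Rightarrow> complex ^ 'n ^ 'm" where
  "ctranspose A = (\<chi> i j. cnj (A $ j $ i))"

definition hermitian :: "complex ^ 'n ^ 'n \<Rightarrow> bool" where
  "hermitian X \<longleftrightarrow> ctranspose X = X"

text \<open>For Hermitian \<open>X\<close> the quadratic form \<open>v\<^sup>* X v\<close> is real, so taking \<open>Re\<close> loses nothing.\<close>

definition psd :: "complex ^ 'n ^ 'n \<Rightarrow> bool" where
  "psd X \<longleftrightarrow> hermitian X \<and>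
     (\<forall>v :: complex ^ 'n. 0 \<le> Re (\<Sum>i\<in>UNIV. cnj (v $ i) * (X *v v) $ i))"

definition frob_inner :: "complex ^ 'n ^ 'n \<Rightarrow> complex ^ 'n ^ 'n \<Rightarrow> complex" where
  "frob_inner X Y = trace (ctranspose X ** Y)"

definition frob_norm :: "complex ^ 'n ^ 'n \<Rightarrow> real" where
  "frob_norm X = sqrt (Re (frob_inner X X))"

lemma Re_frob_inner: "Re (frob_inner X Y) = inner X Y"
proof -
  have "Re (frob_inner X Y) = (\<Sum>i\<in>UNIV. \<Sum>k\<in>UNIV. inner (X $ k $ i) (Y $ k $ i))"
    by (simp add: frob_inner_def trace_def matrix_matrix_mult_def ctranspose_def inner_complex_def)
  also have "\<dots> = (\<Sum>k\<in>UNIV. \<Sum>i\<in>UNIV. inner (X $ k $ i) (Y $ k $ i))"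
    by (rule sum.swap)
  finally show ?thesis by (simp add: inner_vec_def)
qed

text \<open>Hence boundedness and convergence of matrices with respect to the library norm are those
  with respect to the Frobenius norm.\<close>

lemma frob_norm_eq_norm: "frob_norm X = norm X"
  by (simp add: frob_norm_def Re_frob_inner norm_eq_sqrt_inner)

text \<open>For Hermitian \<open>X\<close> the diagonal of \<open>A\<^sup>* X A\<close> is real; \<open>Re\<close> only adjusts the type.\<close>

definition meas :: "complex ^ 'm ^ 'n \<Rightarrow> complex ^ 'n ^ 'n \<Rightarrow> real ^ 'm" where
  "meas A X = (\<chi> j. Re ((ctranspose A ** X ** A) $ j $ j))"

definition Diag :: "real ^ 'm \<Rightarrow> complex ^ 'm ^ 'm" where
  "Diag x = (\<chi> i j. if i = j then complex_of_real (x $ i) else 0)"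

definition meas_adj :: "complex ^ 'm ^ 'n \<Rightarrow> real ^ 'm \<Rightarrow> complex ^ 'n ^ 'n" where
  "meas_adj A x = A ** Diag x ** ctranspose A"

text \<open>The two objectives are real on the feasible set, where \<open>X\<close> and the fixed iterate \<open>Y\<close>
  are Hermitian.\<close>

definition dca_objective ::
  "complex ^ 'm ^ 'n \<Rightarrow> real ^ 'm \<Rightarrow> real \<Rightarrow> complex ^ 'n ^ 'n \<Rightarrow> complex ^ 'n ^ 'n \<Rightarrow> real" where
  "dca_objective A b lam Y X =
     (if Y = 0 then 1 / 2 * (norm (meas A X - b))\<^sup>2 + lam * Re (trace X)
      else 1 / 2 * (norm (meas A X - b))\<^sup>2
             + lam * Re (frob_inner X (mat 1 - (1 / frob_norm Y) *\<^sub>R Y)))"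

text \<open>The subproblems need not have a unique solution; any global minimizer is admitted.\<close>

definition dca_sequence ::
  "complex ^ 'm ^ 'n \<Rightarrow> real ^ 'm \<Rightarrow> real \<Rightarrow> (nat \<Rightarrow> complex ^ 'n ^ 'n) \<Rightarrow> bool" where
  "dca_sequence A b lam X \<longleftrightarrow>
     X 0 = 0 \<and> (\<forall>k. is_arg_min (dca_objective A b lam (X k)) psd (X (Suc k)))"

text \<open>First-order stationarity (KKT) at a nonzero \<open>X\<close> for minimizing
  \<open>1/2 \<parallel>meas A X - b\<parallel>\<^sup>2 + lam (Tr X - \<parallel>X\<parallel>\<^sub>F)\<close> subject to \<open>psd X\<close>. It is not meaningful
  at \<open>X = 0\<close>, where the objective is not differentiable.\<close>

definition kkt_point ::
  "complex ^ 'm ^ 'n \<Rightarrow> real ^ 'm \<Rightarrow> real \<Rightarrow> complex ^ 'n ^ 'n \<Rightarrow> bool" where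
  "kkt_point A b lam X \<longleftrightarrow>
     (\<exists>L :: complex ^ 'n ^ 'n.
        meas_adj A (meas A X - b) + lam *\<^sub>R (mat 1 - (1 / frob_norm X) *\<^sub>R X) = L \<and>
        psd X \<and> psd L \<and> frob_inner X L = 0)"

end

theory Submission
  imports Defs
begin

text \<open>
  Since \<open>sgn 0 = 0\<close>, both kinds of subproblem minimize one and the same convex function
  \<open>1/2 \<parallel>meas A Z - b\<parallel>\<^sup>2 + \<langle>Z, lam (I - sgn P)\<rangle>\<close> over the cone of positive semidefinite matrices, where
  \<open>P\<close> is the current iterate. This function linearizes at \<open>P\<close> the concave part of
  \<open>\<phi>(Z) = 1/2 \<parallel>meas A Z - b\<parallel>\<^sup>2 + lam (Tr Z - \<parallel>Z\<parallel>)\<close>.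

  If \<open>Q\<close> minimizes it, the quadratic part makes its value at \<open>P\<close> exceed its value at \<open>Q\<close> by at least
  \<open>1/2 \<parallel>meas A (Q - P)\<parallel>\<^sup>2\<close>. The error of the linearization contributes a second gain, so that
  (\<open>dca_step_descent\<close>)
  \<open>\<phi>(P) - \<phi>(Q) \<ge> 1/2 \<parallel>meas A (Q - P)\<parallel>\<^sup>2 + lam (\<parallel>Q\<parallel> - \<langle>Q, sgn P\<rangle>)\<close>.

  The rank hypothesis enters through the cone only: \<open>meas A\<close> may have a nontrivial kernel on
  Hermitian matrices, but the only positive semidefinite matrix that it annihilates is \<open>0\<close>
  (\<open>meas_eq_0_psd\<close>). By compactness \<open>\<parallel>meas A Z\<parallel> \<ge> c \<parallel>Z\<parallel>\<close> on the cone, so the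
  sublevel sets of \<open>\<phi>\<close> in the cone are bounded, and with them the sequence.

  Now \<open>\<phi>\<close> decreases along the sequence and is bounded below along it, so both gains tend to \<open>0\<close>. The first
  gain alone does not control \<open>Q - P\<close>, because of the kernel. Both together do: if
  \<open>meas A P = meas A Q\<close> and \<open>\<langle>P, Q\<rangle> = \<parallel>P\<parallel> \<parallel>Q\<parallel>\<close>, then \<open>Q\<close> is a nonnegative multiple of \<open>P\<close>
  (or \<open>P = 0\<close>), and injectivity on the cone makes the factor \<open>1\<close>
  (\<open>equal_if_meas_equal_and_aligned\<close>). Compactness turns this exact statement into
  \<open>X\<^sub>k\<^sub>+\<^sub>1 - X\<^sub>k \<longlonglongrightarrow> 0\<close>.

  Consequently, along a subsequence with limit \<open>Xt \<noteq> 0\<close> the successors converge to \<open>Xt\<close> as well. As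
  \<open>sgn\<close> is continuous at \<open>Xt\<close>, optimality passes to the limit: \<open>Xt\<close> minimizes the
  convex function linearized at \<open>Xt\<close> itself. The first-order conditions for this minimum over a
  cone are exactly the KKT conditions (\<open>minimizer_conic_kkt\<close>).
\<close>

section \<open>Positive semidefinite matrices and the real inner product\<close>

text \<open>With the outer product \<open>v v\<^sup>*\<close> the quadratic form at \<open>v\<close> becomes the linear functional
  \<open>inner (rank_one v)\<close> of the matrix, so that semidefiniteness, the measurements and their
  adjoint can all be handled through the real inner product.\<close>

definition rank_one :: "complex ^ 'n \<Rightarrow> complex ^ 'n ^ 'n" where
  "rank_one v = (\<chi> i j. v $ i * cnj (v $ j))"

lemma hermitian_iff: "hermitian X \<longleftrightarrow> (\<forall>i j. cnj (X $ j $ i) = X $ i $ j)"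
  by (simp add: hermitian_def ctranspose_def vec_eq_iff)

lemma inner_eq_Re_sum: "inner v w = Re (\<Sum>i\<in>UNIV. cnj (v $ i) * w $ i)"
  for v w :: "complex ^ 'n"
  by (simp add: inner_vec_def inner_complex_def)

lemma inner_rank_one: "inner (rank_one v) X = inner v (X *v v)"
proof -
  have "inner (rank_one v) X
      = (\<Sum>i\<in>UNIV. \<Sum>j\<in>UNIV. Re (cnj (v $ i) * (X $ i $ j * v $ j)))"
    by (simp add: rank_one_def inner_vec_def inner_complex_def algebra_simps)
  also have "\<dots> = inner v (X *v v)"
    by (simp add: inner_eq_Re_sum matrix_vector_mult_def sum_distrib_left del: times_complex.simps)
  finally show ?thesis .
qed

lemma psd_iff: "psd X \<longleftrightarrow> hermitian X \<and> (\<forall>v. 0 \<le> inner (rank_one v) X)"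
  by (simp add: psd_def inner_rank_one inner_eq_Re_sum)

lemma hermitian_add: "hermitian X \<Longrightarrow> hermitian Y \<Longrightarrow> hermitian (X + Y)"
  by (simp add: hermitian_iff)

lemma hermitian_scaleR: "hermitian X \<Longrightarrow> hermitian (c *\<^sub>R X)"
  by (simp add: hermitian_iff)

lemma hermitian_mat_1: "hermitian (mat 1)"
  by (simp add: hermitian_iff mat_def)

lemma hermitian_rank_one: "hermitian (rank_one v)"
  by (simp add: hermitian_iff rank_one_def)

lemma psd_zero: "psd 0"
  by (simp add: psd_iff hermitian_iff)

lemma psd_add: "psd X \<Longrightarrow> psd Y \<Longrightarrow> psd (X + Y)"
  by (simp add: psd_iff hermitian_add inner_add_right)

lemma psd_scaleR: "psd X \<Longrightarrow> 0 \<le> c \<Longrightarrow> psd (c *\<^sub>R X)"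
  by (simp add: psd_iff hermitian_scaleR)

lemma psd_rank_one: "psd (rank_one v)"
  unfolding psd_iff
proof (intro conjI allI hermitian_rank_one)
  fix w
  let ?c = "\<Sum>j\<in>UNIV. cnj (v $ j) * w $ j"
  have "rank_one v *v w = ?c *s v"
    by (simp add: vec_eq_iff rank_one_def matrix_vector_mult_def vector_scalar_mult_def
        sum_distrib_right sum_distrib_left algebra_simps)
  then have "inner (rank_one w) (rank_one v) = Re (?c * (\<Sum>i\<in>UNIV. cnj (w $ i) * v $ i))"
    by (simp add: inner_rank_one inner_eq_Re_sum vector_scalar_mult_def sum_distrib_left
        mult.left_commute del: times_complex.simps)
  also have "(\<Sum>i\<in>UNIV. cnj (w $ i) * v $ i) = cnj ?c"
    by (simp add: mult.commute)
  finally show "0 \<le> inner (rank_one w) (rank_one v)"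
    by (simp only: complex_mult_cnj) simp
qed

lemma closed_psd: "closed (Collect psd)"
proof -
  have "Collect psd = (\<Inter>i. \<Inter>j. {X :: complex ^ 'n ^ 'n. cnj (X $ j $ i) = X $ i $ j})
      \<inter> (\<Inter>v. {X. 0 \<le> inner (rank_one v) X})"
    by (auto simp: psd_iff hermitian_iff)
  also have "closed \<dots>"
    by (intro closed_Int closed_INT ballI closed_Collect_eq closed_Collect_le continuous_intros)
  finally show ?thesis .
qed

lemma inner_matrix_vector_hermitian:
  assumes "hermitian X"
  shows "inner (X *v v) w = inner v (X *v w)"
proof -
  have "inner (X *v v) w = Re (\<Sum>i\<in>UNIV. \<Sum>j\<in>UNIV. cnj (X $ i $ j) * cnj (v $ j) * w $ i)"
    by (simp add: inner_eq_Re_sum matrix_vector_mult_def sum_distrib_right del: times_complex.simps)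
  also have "\<dots> = Re (\<Sum>j\<in>UNIV. \<Sum>i\<in>UNIV. cnj (X $ i $ j) * cnj (v $ j) * w $ i)"
    by (subst sum.swap) simp
  also have "\<dots> = Re (\<Sum>j\<in>UNIV. \<Sum>i\<in>UNIV. cnj (v $ j) * (X $ j $ i * w $ i))"
    using assms by (simp add: hermitian_iff mult_ac del: times_complex.simps)
  also have "\<dots> = inner v (X *v w)"
    by (simp add: inner_eq_Re_sum matrix_vector_mult_def sum_distrib_left del: times_complex.simps)
  finally show ?thesis .
qed

text \<open>Divide by \<open>t\<close> and let \<open>t\<close> tend to \<open>0\<close> from the right.\<close>

lemma nonneg_of_first_order:
  fixes a c :: real
  assumes "\<And>t. 0 < t \<Longrightarrow> t \<le> 1 \<Longrightarrow> 0 \<le> t * a + t\<^sup>2 * c"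
  shows "0 \<le> a"
proof (rule tendsto_lowerbound)
  show "((\<lambda>t. a + t * c) \<longlongrightarrow> a) (at_right 0)"
    by (auto intro!: tendsto_eq_intros)
  have "0 \<le> a + t * c" if "0 < t" "t \<le> 1" for t
  proof -
    have "0 \<le> t * (a + t * c)"
      using assms[OF that] by (simp add: algebra_simps power2_eq_square)
    with \<open>0 < t\<close> show ?thesis
      by (simp add: zero_le_mult_iff)
  qed
  then show "\<forall>\<^sub>F t in at_right 0. 0 \<le> a + t * c"
    unfolding eventually_at_right_field by (intro exI[of _ 1]) auto
qed simp

lemma matrix_vector_mult_scaleR_complex: "X *v (t *\<^sub>R v) = t *\<^sub>R (X *v v)"
  for X :: "complex ^ 'n ^ 'm"
  by (simp add: vec_eq_iff matrix_vector_mult_def scaleR_sum_right)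

text \<open>A null vector of the form is a minimizer of it. Moving from \<open>v\<close> to \<open>v - t X v\<close> changes the form
  by \<open>- 2 t \<parallel>X v\<parallel>\<^sup>2\<close> to first order, which must not be negative.\<close>

lemma psd_mult_eq_0:
  assumes "psd X" and "inner (rank_one v) X = 0"
  shows "X *v v = 0"
proof -
  define u where "u = X *v v"
  have "0 \<le> t * (- 2 * inner u u) + t\<^sup>2 * inner u (X *v u)" for t
  proof -
    have "0 \<le> inner (v - t *\<^sub>R u) (X *v (v - t *\<^sub>R u))"
      using assms(1) by (simp add: psd_iff inner_rank_one)
    also have "X *v (v - t *\<^sub>R u) = u - t *\<^sub>R (X *v u)"
      by (simp add: matrix_vector_mult_diff_distrib matrix_vector_mult_scaleR_complex u_def)
    also have "inner (v - t *\<^sub>R u) (u - t *\<^sub>R (X *v u))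
        = inner v u - t * inner v (X *v u) - t * inner u u + t\<^sup>2 * inner u (X *v u)"
      by (simp add: inner_diff_left inner_diff_right algebra_simps power2_eq_square)
    also have "inner v (X *v u) = inner u u"
      using assms(1) by (simp add: psd_iff inner_matrix_vector_hermitian[symmetric] u_def)
    also have "inner v u = 0"
      using assms(2) by (simp add: inner_rank_one u_def)
    finally show ?thesis by simp
  qed
  then have "0 \<le> - 2 * inner u u"
    by (rule nonneg_of_first_order)
  then have "inner u u = 0"
    using inner_ge_zero[of u] by linarith
  then show ?thesis
    by (simp add: u_def)
qed

section \<open>The measurement operator and its adjoint\<close>

lemma meas_nth: "meas A X $ j = inner (rank_one (column j A)) X"
proof -
  have "meas A X $ j = Re (\<Sum>k\<in>UNIV. \<Sum>i\<in>UNIV. cnj (A $ i $ j) * X $ i $ k * A $ k $ j)"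
    by (simp add: meas_def matrix_matrix_mult_def ctranspose_def sum_distrib_right
        del: times_complex.simps)
  also have "\<dots> = Re (\<Sum>i\<in>UNIV. \<Sum>k\<in>UNIV. cnj (A $ i $ j) * X $ i $ k * A $ k $ j)"
    by (subst sum.swap) simp
  also have "\<dots> = inner (rank_one (column j A)) X"
    by (simp add: inner_rank_one inner_eq_Re_sum matrix_vector_mult_def column_def
        sum_distrib_left mult.assoc del: times_complex.simps)
  finally show ?thesis .
qed

lemma linear_meas: "linear (meas A)"
  by (rule linearI) (simp_all add: vec_eq_iff meas_nth inner_add_right)

lemma continuous_on_meas [continuous_intros]:
  assumes "continuous_on S f"
  shows "continuous_on S (\<lambda>x. meas A (f x))"
proof -
  have "continuous_on UNIV (meas A)"
    using linear_meas[of A] by (simp add: linear_continuous_on linear_conv_bounded_linear)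
  then show ?thesis
    by (rule continuous_on_compose2[OF _ assms]) simp
qed

lemma meas_adj_eq_sum: "meas_adj A y = (\<Sum>j\<in>UNIV. y $ j *\<^sub>R rank_one (column j A))"
proof -
  have "(A ** Diag y) $ i $ j = A $ i $ j * complex_of_real (y $ j)" for i j
    by (simp add: matrix_matrix_mult_def Diag_def if_distrib cong: if_cong)
  then have "meas_adj A y $ i $ k = (\<Sum>j\<in>UNIV. y $ j *\<^sub>R (A $ i $ j * cnj (A $ k $ j)))" for i k
    by (simp add: meas_adj_def matrix_matrix_mult_def[of "A ** Diag y"] ctranspose_def
        scaleR_conv_of_real mult_ac)
  then show ?thesis
    by (simp add: vec_eq_iff rank_one_def column_def)
qed

lemma inner_meas_adj: "inner (meas_adj A y) X = inner y (meas A X)"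
  by (simp add: meas_adj_eq_sum inner_sum_left inner_vec_def[of y] meas_nth)

lemma hermitian_meas_adj: "hermitian (meas_adj A y)"
  by (simp add: hermitian_iff meas_adj_eq_sum rank_one_def mult.commute)

section \<open>Injectivity of the measurements on the semidefinite cone\<close>

text \<open>The rank is the dimension of the span of the rows. If it equals their number, the rows are
  pairwise distinct and linearly independent.\<close>

lemma full_row_rank_right_inverse:
  fixes A :: "'a::field ^ 'm ^ 'n"
  assumes "rank A = CARD('n)"
  shows "\<exists>B. A ** B = mat 1"
proof -
  have rows: "rows A = range (\<lambda>i. row i A)"
    by (auto simp: rows_def)
  have "card (rows A) \<le> vec.dim (rows A)"
    using assms card_image_le[of UNIV "\<lambda>i. row i A"] by (simp add: row_rank_def_gen rows)
  then have indep: "vec.independent (rows A)"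
    by (intro vec.card_le_dim_spanning[of _ "rows A"]) (auto simp: vec.span_superset rows)
  have "CARD('n) \<le> card (range (\<lambda>i. row i A))"
    using assms vec.dim_le_card'[of "rows A"] by (simp add: row_rank_def_gen rows)
  then have inj: "inj (\<lambda>i. row i A)"
    using card_image_le[of UNIV "\<lambda>i. row i A"] by (intro eq_card_imp_inj_on) simp_all
  have "\<forall>i. c i = 0" if "(\<Sum>i\<in>UNIV. c i *s row i A) = 0" for c
  proof -
    have "(\<Sum>r\<in>rows A. c (inv (\<lambda>i. row i A) r) *s r) = 0"
      using that by (simp add: rows sum.reindex[OF inj] inv_f_f[OF inj])
    then have "\<forall>r\<in>rows A. c (inv (\<lambda>i. row i A) r) = 0"
      using vec.independentD[OF indep, of "rows A" "\<lambda>r. c (inv (\<lambda>i. row i A) r)"]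
      by (simp add: rows)
    then show ?thesis
      by (simp add: rows inv_f_f[OF inj])
  qed
  then show ?thesis
    by (simp add: matrix_right_invertible_independent_rows)
qed

text \<open>Vanishing measurements say that each column of \<open>A\<close> is a null vector of the form, hence lies in
  the kernel of \<open>X\<close>; thus \<open>X A = 0\<close>, and \<open>A\<close> can be cancelled.\<close>

lemma meas_eq_0_psd:
  fixes A :: "complex ^ 'm ^ 'n"
  assumes "rank A = CARD('n)" and "psd X" and "meas A X = 0"
  shows "X = 0"
proof -
  have "X *v column j A = 0" for j
    using assms(2,3) by (intro psd_mult_eq_0) (simp_all flip: meas_nth)
  then have "X ** A = 0"
    by (simp add: vec_eq_iff matrix_matrix_mult_def matrix_vector_mult_def column_def)
  moreover obtain B where "A ** B = mat 1"
    using full_row_rank_right_inverse[OF assms(1)] by blast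
  ultimately have "X = 0 ** B"
    by (metis matrix_mul_assoc matrix_mul_rid)
  then show ?thesis
    by (simp add: matrix_matrix_mult_def vec_eq_iff)
qed

text \<open>The constant is the minimum of \<open>\<parallel>meas A X\<parallel>\<close> over the compact set of semidefinite
  matrices of norm \<open>1\<close>; homogeneity does the rest.\<close>

lemma meas_bounded_below_psd:
  fixes A :: "complex ^ 'm ^ 'n"
  assumes "rank A = CARD('n)"
  obtains c where "c > 0" and "\<And>X. psd X \<Longrightarrow> c * norm X \<le> norm (meas A X)"
proof -
  let ?S = "Collect psd \<inter> sphere 0 1 :: (complex ^ 'n ^ 'n) set"
  have "compact ?S"
    by (intro closed_Int_compact closed_psd compact_sphere)
  moreover have "continuous_on ?S (\<lambda>X. norm (meas A X))"
    by (intro continuous_intros)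
  moreover have "\<forall>X\<in>?S. norm (meas A X) > 0"
    using meas_eq_0_psd[OF assms] by fastforce
  ultimately obtain c where c: "c > 0" "\<And>X. X \<in> ?S \<Longrightarrow> c \<le> norm (meas A X)"
  proof (cases "?S = {}")
    case True
    then show ?thesis using that[of 1] by auto
  next
    case False
    then obtain Y where "Y \<in> ?S" "\<forall>X\<in>?S. norm (meas A Y) \<le> norm (meas A X)"
      using continuous_attains_inf[OF \<open>compact ?S\<close> _ \<open>continuous_on ?S _\<close>] by blast
    then show ?thesis
      using that[of "norm (meas A Y)"] \<open>\<forall>X\<in>?S. norm (meas A X) > 0\<close> by blast
  qed
  show ?thesis
  proof (rule that[OF c(1)])
    fix X :: "complex ^ 'n ^ 'n" assume "psd X"
    show "c * norm X \<le> norm (meas A X)"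
    proof (cases "X = 0")
      case False
      then have "(1 / norm X) *\<^sub>R X \<in> ?S"
        using \<open>psd X\<close> by (auto intro: psd_scaleR)
      then have "c \<le> norm (meas A ((1 / norm X) *\<^sub>R X))"
        by (rule c(2))
      also have "\<dots> = norm (meas A X) / norm X"
        by (simp add: linear_cmul[OF linear_meas])
      finally show ?thesis
        using False by (simp add: field_simps)
    qed simp
  qed
qed

section \<open>Minimizing a least-squares term plus a linear term over the cone\<close>

definition ls_plus_linear ::
  "complex ^ 'm ^ 'n \<Rightarrow> real ^ 'm \<Rightarrow> complex ^ 'n ^ 'n \<Rightarrow> complex ^ 'n ^ 'n \<Rightarrow> real" where
  "ls_plus_linear A b C X = 1 / 2 * (norm (meas A X - b))\<^sup>2 + inner X C"

lemma Re_trace: "Re (trace X) = inner X (mat 1)"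
proof -
  have "inner X (mat 1) = (\<Sum>i\<in>UNIV. \<Sum>j\<in>UNIV. if i = j then Re (X $ i $ j) else 0)"
    unfolding inner_vec_def mat_def by (intro sum.cong refl) (auto simp: inner_complex_def)
  then show ?thesis by (simp add: trace_def)
qed

text \<open>The value \<open>sgn 0 = 0\<close> absorbs the case distinction.\<close>

lemma dca_objective_eq:
  "dca_objective A b lam Y = ls_plus_linear A b (lam *\<^sub>R (mat 1 - sgn Y))"
  by (rule ext)
    (simp add: dca_objective_def ls_plus_linear_def Re_trace Re_frob_inner frob_norm_eq_norm sgn_div_norm
      inverse_eq_divide)

text \<open>The function is quadratic, so its second-order expansion is exact, with gradient
  \<open>meas_adj A (meas A Q - b) + C\<close>.\<close>

lemma ls_plus_linear_expand:
  fixes A :: "complex ^ 'm ^ 'n"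
  shows "ls_plus_linear A b C (Q + D) = ls_plus_linear A b C Q
     + inner (meas_adj A (meas A Q - b) + C) D + 1 / 2 * (norm (meas A D))\<^sup>2"
proof -
  have "meas A (Q + D) - b = (meas A Q - b) + meas A D"
    by (simp add: linear_add[OF linear_meas])
  moreover have "(norm (u + w))\<^sup>2 = (norm u)\<^sup>2 + 2 * inner u w + (norm w)\<^sup>2" for u w :: "real ^ 'm"
    by (simp add: power2_norm_eq_inner inner_add_left inner_add_right inner_commute)
  ultimately have "(norm (meas A (Q + D) - b))\<^sup>2
      = (norm (meas A Q - b))\<^sup>2 + 2 * inner (meas A Q - b) (meas A D) + (norm (meas A D))\<^sup>2"
    by (simp only:)
  then show ?thesis
    by (simp add: ls_plus_linear_def inner_meas_adj inner_add_left inner_add_right inner_commute[of _ C]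
        field_simps)
qed

lemma minimizer_variational:
  assumes "psd Q" and "\<And>Z. psd Z \<Longrightarrow> ls_plus_linear A b C Q \<le> ls_plus_linear A b C Z" and "psd Z"
  shows "0 \<le> inner (meas_adj A (meas A Q - b) + C) (Z - Q)"
proof (rule nonneg_of_first_order)
  fix t :: real assume t: "0 < t" "t \<le> 1"
  have "Q + t *\<^sub>R (Z - Q) = (1 - t) *\<^sub>R Q + t *\<^sub>R Z"
    by (simp add: algebra_simps)
  then have "psd (Q + t *\<^sub>R (Z - Q))"
    using t assms(1,3) by (simp add: psd_add psd_scaleR)
  then have "ls_plus_linear A b C Q \<le> ls_plus_linear A b C (Q + t *\<^sub>R (Z - Q))"
    by (rule assms(2))
  then show "0 \<le> t * inner (meas_adj A (meas A Q - b) + C) (Z - Q)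
      + t\<^sup>2 * (1 / 2 * (norm (meas A (Z - Q)))\<^sup>2)"
    by (simp add: ls_plus_linear_expand linear_cmul[OF linear_meas] power_mult_distrib)
qed

text \<open>The quadratic term of the exact expansion survives once the linear one is known to be
  nonnegative.\<close>

lemma minimizer_growth:
  assumes "psd Q" and "\<And>Z. psd Z \<Longrightarrow> ls_plus_linear A b C Q \<le> ls_plus_linear A b C Z" and "psd Z"
  shows "ls_plus_linear A b C Q + 1 / 2 * (norm (meas A (Z - Q)))\<^sup>2 \<le> ls_plus_linear A b C Z"
  using minimizer_variational[OF assms] ls_plus_linear_expand[of A b C Q "Z - Q"] by simp

text \<open>In a cone, the variational inequality can be tested at \<open>0\<close> and \<open>2 Q\<close>, which gives
  complementary slackness, and at \<open>Q + v v\<^sup>*\<close>, which gives dual feasibility.\<close>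

lemma minimizer_conic_kkt:
  assumes "psd Q" and "\<And>Z. psd Z \<Longrightarrow> ls_plus_linear A b C Q \<le> ls_plus_linear A b C Z" and "hermitian C"
  defines "L \<equiv> meas_adj A (meas A Q - b) + C"
  shows "psd L \<and> inner Q L = 0"
proof -
  have vi: "0 \<le> inner L (Z - Q)" if "psd Z" for Z
    using minimizer_variational[OF assms(1,2) that] by (simp add: L_def)
  have "inner L Q = 0"
    using vi[OF psd_zero] vi[OF psd_add[OF assms(1) assms(1)]] by simp
  moreover have "psd L"
    unfolding psd_iff
  proof (intro conjI allI)
    show "hermitian L"
      unfolding L_def by (intro hermitian_add hermitian_meas_adj assms(3))
    show "0 \<le> inner (rank_one v) L" for v
      using vi[OF psd_add[OF assms(1) psd_rank_one[of v]]] by (simp add: inner_commute)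
  qed
  ultimately show ?thesis by (simp add: inner_commute)
qed

text \<open>Complementary slackness is an equation between complex numbers; this lemma shows that its
  imaginary part holds automatically.\<close>

lemma frob_inner_hermitian:
  assumes "hermitian X" and "hermitian Y"
  shows "frob_inner X Y = complex_of_real (inner X Y)"
proof -
  have "cnj (frob_inner X Y) = (\<Sum>i\<in>UNIV. \<Sum>k\<in>UNIV. X $ k $ i * cnj (Y $ k $ i))"
    by (simp add: frob_inner_def trace_def matrix_matrix_mult_def ctranspose_def)
  also have "\<dots> = (\<Sum>i\<in>UNIV. \<Sum>k\<in>UNIV. cnj (X $ i $ k) * Y $ i $ k)"
    using assms by (simp add: hermitian_iff)
  also have "\<dots> = (\<Sum>k\<in>UNIV. \<Sum>i\<in>UNIV. cnj (X $ i $ k) * Y $ i $ k)"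
    by (rule sum.swap)
  also have "\<dots> = frob_inner X Y"
    by (simp add: frob_inner_def trace_def matrix_matrix_mult_def ctranspose_def)
  finally show ?thesis
    by (simp add: complex_eq_iff Re_frob_inner)
qed

section \<open>Descent of the difference-of-convex objective\<close>

definition dc_objective where
  "dc_objective A b lam X = ls_plus_linear A b (lam *\<^sub>R mat 1) X - lam * norm X"

lemma inner_sgn_self: "inner X (sgn X) = norm X" for X :: "'a::real_inner"
  by (cases "X = 0") (simp_all add: sgn_div_norm power2_norm_eq_inner[symmetric] power2_eq_square)

text \<open>The linearized objective majorizes the objective itself, with equality at \<open>X = P\<close> (including
  \<open>P = 0\<close>) by \<open>inner_sgn_self\<close>; the difference is the linearization error of the norm.\<close>

lemma dc_objective_eq_ls_plus_linear:
  "dc_objective A b lam X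
     = ls_plus_linear A b (lam *\<^sub>R (mat 1 - sgn P)) X - lam * (norm X - inner X (sgn P))"
  by (simp add: dc_objective_def ls_plus_linear_def inner_diff_right algebra_simps)

lemma dca_step_descent:
  assumes "psd P" and "psd Q"
    and "\<And>Z. psd Z \<Longrightarrow> dca_objective A b lam P Q \<le> dca_objective A b lam P Z"
  shows "1 / 2 * (norm (meas A (Q - P)))\<^sup>2 + lam * (norm Q - inner Q (sgn P))
    \<le> dc_objective A b lam P - dc_objective A b lam Q"
proof -
  have "ls_plus_linear A b (lam *\<^sub>R (mat 1 - sgn P)) Q + 1 / 2 * (norm (meas A (P - Q)))\<^sup>2
      \<le> ls_plus_linear A b (lam *\<^sub>R (mat 1 - sgn P)) P"
    using assms by (intro minimizer_growth) (simp_all add: dca_objective_eq)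
  moreover have "meas A (P - Q) = - meas A (Q - P)"
    by (simp add: linear_diff[OF linear_meas])
  ultimately show ?thesis
    by (simp add: dc_objective_eq_ls_plus_linear[of A b lam _ P] inner_sgn_self)
qed

lemma inner_sgn_le_norm: "inner Q (sgn P) \<le> norm Q" for Q :: "'a::real_inner"
  using norm_cauchy_schwarz[of Q "sgn P"] by (cases "P = 0") (auto simp: norm_sgn)

section \<open>Bounded sublevel sets\<close>

lemma trace_psd_nonneg:
  assumes "psd X"
  shows "0 \<le> inner X (mat 1)"
proof -
  have "0 \<le> Re (X $ i $ i)" for i
  proof -
    have "0 \<le> inner (axis i 1) (X *v axis i 1)"
      using assms by (simp add: psd_iff inner_rank_one)
    moreover have "(X *v axis i 1) $ i = X $ i $ i"
      by (simp add: matrix_vector_mult_def axis_def if_distrib cong: if_cong)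
    ultimately show ?thesis
      by (simp add: inner_axis' inner_complex_def)
  qed
  then show ?thesis
    by (simp add: Re_trace[symmetric] trace_def sum_nonneg)
qed

lemma quadratic_sublevel_bound:
  fixes t :: real
  assumes "1 / 2 * t\<^sup>2 \<le> K + L * t" and "0 \<le> K" and "0 \<le> L"
  shows "t \<le> 2 * L + 2 * K + 1"
proof (rule ccontr)
  assume "\<not> ?thesis"
  then have t: "t > 2 * L + 2 * K + 1" by simp
  then have "t * (2 * L + 2 * K) \<ge> 2 * K + 2 * L * t"
    using assms(2,3) mult_right_mono[of 1 t "2 * K"] by (simp add: algebra_simps)
  moreover have "t * t > t * (2 * L + 2 * K)"
    using t assms(2,3) by (intro mult_strict_left_mono) auto
  ultimately show False
    using assms(1) by (simp add: power2_eq_square)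
qed

text \<open>The trace is nonnegative on the cone, so only \<open>- lam \<parallel>X\<parallel>\<close> can be negative. Its size
  grows at most linearly in the residual \<open>t\<close>, because \<open>c \<parallel>X\<parallel> \<le> \<parallel>meas A X\<parallel> \<le> t + \<parallel>b\<parallel>\<close>, and
  \<open>1/2 t\<^sup>2\<close> dominates it.\<close>

lemma bounded_dc_sublevel:
  fixes A :: "complex ^ 'm ^ 'n"
  assumes "rank A = CARD('n)" and "lam > 0"
  shows "bounded {X. psd X \<and> dc_objective A b lam X \<le> \<alpha>}"
proof -
  obtain c where c: "c > 0" "\<And>X. psd X \<Longrightarrow> c * norm X \<le> norm (meas A X)"
    using meas_bounded_below_psd[OF assms(1)] by blast
  define K where "K = max 0 \<alpha> + lam / c * norm b"
  define R where "R = (2 * (lam / c) + 2 * K + 1 + norm b) / c"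
  have "norm X \<le> R" if X: "psd X" "dc_objective A b lam X \<le> \<alpha>" for X
  proof -
    define t where "t = norm (meas A X - b)"
    have le: "c * norm X \<le> t + norm b"
      using c(2)[OF X(1)] norm_triangle_sub[of "meas A X" b] by (simp add: t_def)
    have "1 / 2 * t\<^sup>2 \<le> \<alpha> + lam * norm X"
      using X(2) mult_nonneg_nonneg[OF less_imp_le[OF assms(2)] trace_psd_nonneg[OF X(1)]]
      by (simp add: dc_objective_def ls_plus_linear_def t_def)
    also have "lam * norm X = lam / c * (c * norm X)"
      using c(1) by simp
    also have "\<alpha> + lam / c * (c * norm X) \<le> max 0 \<alpha> + lam / c * (t + norm b)"
      using le assms(2) c(1) by (intro add_mono mult_left_mono) auto
    finally have "1 / 2 * t\<^sup>2 \<le> K + lam / c * t"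
      by (simp add: K_def algebra_simps)
    then have "t \<le> 2 * (lam / c) + 2 * K + 1"
      using assms(2) c(1) by (intro quadratic_sublevel_bound) (auto simp: K_def)
    then show ?thesis
      using le c(1) by (simp add: R_def pos_le_divide_eq mult.commute)
  qed
  then show ?thesis
    by (auto simp: bounded_iff)
qed

section \<open>Vanishing gains force vanishing steps\<close>

text \<open>Equality in the Cauchy-Schwarz inequality makes \<open>Q\<close> a multiple \<open>s P\<close> when \<open>P \<noteq> 0\<close>. Then
  \<open>(s - 1) meas A P = 0\<close>, and \<open>meas A P \<noteq> 0\<close>.\<close>

lemma equal_if_meas_equal_and_aligned:
  fixes A :: "complex ^ 'm ^ 'n"
  assumes "rank A = CARD('n)" and "psd P" and "psd Q"
    and "meas A (Q - P) = 0" and "norm P * norm Q = inner P Q"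
  shows "Q = P"
proof (cases "P = 0")
  case True
  then show ?thesis
    using meas_eq_0_psd[OF assms(1,3)] assms(4) by simp
next
  case False
  define s where "s = norm Q / norm P"
  have "norm P *\<^sub>R Q = norm Q *\<^sub>R P"
    using assms(5)[symmetric] by (simp add: norm_cauchy_schwarz_eq)
  then have Q: "Q = s *\<^sub>R P"
    using False unfolding s_def by (metis divide_inverse_commute inverse_eq_divide
        norm_eq_zero scaleR_scaleR right_inverse scaleR_one mult.commute)
  then have "meas A (Q - P) = (s - 1) *\<^sub>R meas A P"
    by (simp add: linear_diff[OF linear_meas] linear_cmul[OF linear_meas] scaleR_diff_left)
  moreover have "meas A P \<noteq> 0"
    using meas_eq_0_psd[OF assms(1,2)] False by blast
  ultimately have "s = 1"
    using assms(4) by simp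
  then show ?thesis
    using Q by simp
qed

text \<open>Where \<open>G \<ge> e\<close>, the function \<open>F\<close> is positive, hence bounded away from \<open>0\<close> by compactness; a
  sequence with \<open>F\<close> tending to \<open>0\<close> leaves this set.\<close>

lemma tendsto_zero_compact_residual:
  fixes F G :: "'a::topological_space \<Rightarrow> real"
  assumes "compact K" and "continuous_on K F" and "continuous_on K G"
    and nonneg: "\<And>x. x \<in> K \<Longrightarrow> 0 \<le> F x" "\<And>x. x \<in> K \<Longrightarrow> 0 \<le> G x"
    and zero: "\<And>x. x \<in> K \<Longrightarrow> F x = 0 \<Longrightarrow> G x = 0"
    and s: "\<And>k. s k \<in> K" "(\<lambda>k. F (s k)) \<longlonglongrightarrow> 0"
  shows "(\<lambda>k. G (s k)) \<longlonglongrightarrow> 0"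
proof (rule tendstoI)
  fix e :: real assume "e > 0"
  define T where "T = K \<inter> G -` {e..}"
  have "compact T"
    unfolding T_def using assms(1,3)
    by (intro closedin_compact[OF assms(1)] continuous_closedin_preimage) auto
  show "\<forall>\<^sub>F k in sequentially. dist (G (s k)) 0 < e"
  proof (cases "T = {}")
    case True
    then have "G (s k) < e" for k
      using s(1)[of k] by (fastforce simp: T_def)
    then show ?thesis
      using nonneg(2)[OF s(1)] by simp
  next
    case False
    have "continuous_on T F"
      using assms(2) by (rule continuous_on_subset) (simp add: T_def)
    then obtain x where x: "x \<in> T" "\<forall>y\<in>T. F x \<le> F y"
      using continuous_attains_inf[OF \<open>compact T\<close> False] by blast
    then have "F x > 0"
      using zero[of x] nonneg(1)[of x] \<open>e > 0\<close> by (fastforce simp: T_def)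
    with s(2) have "\<forall>\<^sub>F k in sequentially. F (s k) < F x"
      by (rule order_tendstoD)
    then show ?thesis
    proof eventually_elim
      case (elim k)
      then have "s k \<notin> T"
        using x(2) by force
      then show ?case
        using s(1)[of k] nonneg(2)[OF s(1)[of k]] by (simp add: T_def)
    qed
  qed
qed

section \<open>Convergence of the algorithm\<close>

theorem proposition4p1:
  fixes A :: "complex ^ 'm ^ 'n"
    and b :: "real ^ 'm"
    and lam :: real
    and X :: "nat \<Rightarrow> complex ^ 'n ^ 'n"
  assumes "CARD('m) \<ge> CARD('n)"
    and "rank A = CARD('n)"
    and "lam > 0"
    and "dca_sequence A b lam X"
  shows "bounded (range X) \<and>
    (\<lambda>k. X (Suc k) - X k) \<longlonglongrightarrow> 0 \<and>
    (\<forall>Xt. Xt \<noteq> 0 \<and> (\<exists>r. strict_mono r \<and> (X \<circ> r) \<longlonglongrightarrow> Xt) \<longrightarrow> kkt_point A b lam Xt)"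
proof -
  let ?\<phi> = "\<lambda>k. dc_objective A b lam (X k)"
  have psdX: "psd (X k)" for k
    using assms(4) by (cases k) (auto simp: dca_sequence_def is_arg_min_def psd_zero)
  have opt: "dca_objective A b lam (X k) (X (Suc k)) \<le> dca_objective A b lam (X k) Z"
    if "psd Z" for k Z
    using assms(4) that by (force simp: dca_sequence_def is_arg_min_def not_less)
  define gap where "gap k = norm (X (Suc k)) - inner (X (Suc k)) (sgn (X k))" for k
  have gap_nonneg: "0 \<le> gap k" for k
    by (simp add: gap_def inner_sgn_le_norm)
  have descent: "1 / 2 * (norm (meas A (X (Suc k) - X k)))\<^sup>2 + lam * gap k \<le> ?\<phi> k - ?\<phi> (Suc k)" for k
    unfolding gap_def by (intro dca_step_descent psdX opt)
  have gain_nonneg: "0 \<le> lam * gap k" for k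
    using gap_nonneg assms(3) by simp
  have step: "?\<phi> (Suc k) \<le> ?\<phi> k" for k
    using descent[of k] gain_nonneg[of k] zero_le_power2[of "norm (meas A (X (Suc k) - X k))"]
    by linarith
  have "?\<phi> k \<le> ?\<phi> 0" for k
    by (induction k) (use step order_trans in auto)
  then have "range X \<subseteq> {Y. psd Y \<and> dc_objective A b lam Y \<le> ?\<phi> 0}"
    using psdX by auto
  then have bdd: "bounded (range X)"
    using bounded_dc_sublevel[OF assms(2,3)] bounded_subset by blast
  then obtain R where R: "\<And>k. norm (X k) \<le> R"
    by (auto simp: bounded_iff)

  have "- (lam * R) \<le> ?\<phi> k" for k
  proof -
    have "lam * norm (X k) \<le> lam * R"
      using R assms(3) by (intro mult_left_mono) auto
    moreover have "0 \<le> lam * inner (X k) (mat 1)"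
      using trace_psd_nonneg[OF psdX] assms(3) by simp
    ultimately show ?thesis
      using zero_le_power2[of "norm (meas A (X k) - b)"]
      unfolding dc_objective_def ls_plus_linear_def inner_scaleR_right by linarith
  qed
  moreover have "decseq ?\<phi>"
    using step by (rule decseq_SucI)
  ultimately obtain l where "?\<phi> \<longlonglongrightarrow> l"
    using decseq_convergent by blast
  then have dec0: "(\<lambda>k. ?\<phi> k - ?\<phi> (Suc k)) \<longlonglongrightarrow> 0"
    using tendsto_diff[OF _ LIMSEQ_Suc] by fastforce

  \<comment> \<open>The second term uses the gap multiplied by \<open>\<parallel>P\<parallel>\<close>: the gap itself jumps at \<open>P = 0\<close>, whereas \<open>F\<close> is
      continuous on pairs. The iterates are bounded, so \<open>F\<close> still tends to \<open>0\<close> along them.\<close>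
  define F where "F = (\<lambda>(P, Q). 1 / 2 * (norm (meas A (Q - P)))\<^sup>2 + lam * (norm P * norm Q - inner P Q))"
  let ?B = "Collect psd \<inter> cball 0 R :: (complex ^ 'n ^ 'n) set"
  let ?K = "?B \<times> ?B"
  have F_le: "F (X k, X (Suc k)) \<le> (1 + R) * (?\<phi> k - ?\<phi> (Suc k))" for k
  proof -
    have "norm (X k) * norm (X (Suc k)) - inner (X k) (X (Suc k)) = norm (X k) * gap k"
      by (cases "X k = 0") (simp_all add: gap_def sgn_div_norm algebra_simps inner_commute)
    also have "\<dots> \<le> (1 + R) * gap k"
      using R[of k] gap_nonneg by (intro mult_right_mono) auto
    finally have "lam * (norm (X k) * norm (X (Suc k)) - inner (X k) (X (Suc k)))
        \<le> (1 + R) * (lam * gap k)"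
      using assms(3) by (simp add: mult.left_commute)
    moreover have "0 \<le> R"
      using R[of 0] norm_ge_zero order_trans by blast
    moreover from this have "1 * (1 / 2 * (norm (meas A (X (Suc k) - X k)))\<^sup>2)
        \<le> (1 + R) * (1 / 2 * (norm (meas A (X (Suc k) - X k)))\<^sup>2)"
      by (intro mult_right_mono) auto
    ultimately have "F (X k, X (Suc k))
        \<le> (1 + R) * (1 / 2 * (norm (meas A (X (Suc k) - X k)))\<^sup>2 + lam * gap k)"
      unfolding F_def prod.case distrib_left[of "1 + R"] by linarith
    also have "\<dots> \<le> (1 + R) * (?\<phi> k - ?\<phi> (Suc k))"
      using descent \<open>0 \<le> R\<close> by (intro mult_left_mono) auto
    finally show ?thesis .
  qed
  have F_nonneg: "0 \<le> F x" for x
    using assms(3) norm_cauchy_schwarz[of "fst x" "snd x"] by (simp add: F_def split_beta)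
  have F0: "(\<lambda>k. F (X k, X (Suc k))) \<longlonglongrightarrow> 0"
    by (rule tendsto_sandwich[OF _ _ tendsto_const tendsto_mult_right_zero[OF dec0, of "1 + R"]])
      (simp_all add: F_nonneg F_le)
  have "(\<lambda>k. norm (snd (X k, X (Suc k)) - fst (X k, X (Suc k)))) \<longlonglongrightarrow> 0"
  proof (rule tendsto_zero_compact_residual[of ?K F "\<lambda>x. norm (snd x - fst x)" "\<lambda>k. (X k, X (Suc k))"])
    show "compact ?K"
      by (intro compact_Times closed_Int_compact closed_psd compact_cball)
    show "continuous_on ?K F"
      unfolding F_def split_beta by (intro continuous_intros)
    show "continuous_on ?K (\<lambda>x. norm (snd x - fst x))"
      by (intro continuous_intros)
    show "norm (snd x - fst x) = 0" if "x \<in> ?K" "F x = 0" for x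
    proof -
      have "0 \<le> lam * (norm (fst x) * norm (snd x) - inner (fst x) (snd x))"
        using assms(3) norm_cauchy_schwarz[of "fst x" "snd x"] by simp
      then have "(norm (meas A (snd x - fst x)))\<^sup>2 = 0"
        and "lam * (norm (fst x) * norm (snd x) - inner (fst x) (snd x)) = 0"
        using that(2) zero_le_power2[of "norm (meas A (snd x - fst x))"]
        unfolding F_def split_beta by linarith+
      then have "snd x = fst x"
        using that(1) assms(3) by (intro equal_if_meas_equal_and_aligned[OF assms(2)]) auto
      then show ?thesis by simp
    qed
  qed (use F_nonneg psdX R F0 in auto)
  then have diff0: "(\<lambda>k. X (Suc k) - X k) \<longlonglongrightarrow> 0"
    by (simp add: tendsto_norm_zero_iff)

  have "kkt_point A b lam Xt" if "Xt \<noteq> 0" "strict_mono r" "(X \<circ> r) \<longlonglongrightarrow> Xt" for Xt r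
  proof -
    have lim: "(\<lambda>j. X (r j)) \<longlonglongrightarrow> Xt"
      using that(3) by (simp add: comp_def)
    have "(\<lambda>j. (X (Suc (r j)) - X (r j)) + X (r j)) \<longlonglongrightarrow> 0 + Xt"
      using LIMSEQ_subseq_LIMSEQ[OF diff0 that(2)] lim
      by (intro tendsto_add) (simp_all add: comp_def)
    then have lim_Suc: "(\<lambda>j. X (Suc (r j))) \<longlonglongrightarrow> Xt"
      by simp
    have psdXt: "psd Xt"
      using closed_sequentially[OF closed_psd _ lim] psdX by simp
    define C where "C = lam *\<^sub>R (mat 1 - sgn Xt)"
    have meas_lim: "(\<lambda>j. meas A (X (Suc (r j)))) \<longlonglongrightarrow> meas A Xt"
      using continuous_on_tendsto_compose[OF continuous_on_meas[OF continuous_on_id, of UNIV A] lim_Suc]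
      by simp
    \<comment> \<open>\<open>Xt \<noteq> 0\<close> is what makes the linearizations converge: \<open>sgn\<close> is discontinuous at \<open>0\<close>.\<close>
    have "ls_plus_linear A b C Xt \<le> ls_plus_linear A b C Z" if "psd Z" for Z
    proof (rule tendsto_le[OF trivial_limit_sequentially])
      show "(\<lambda>j. ls_plus_linear A b (lam *\<^sub>R (mat 1 - sgn (X (r j)))) (X (Suc (r j)))) \<longlonglongrightarrow> ls_plus_linear A b C Xt"
        unfolding ls_plus_linear_def C_def by (intro tendsto_intros meas_lim lim lim_Suc \<open>Xt \<noteq> 0\<close>)
      show "(\<lambda>j. ls_plus_linear A b (lam *\<^sub>R (mat 1 - sgn (X (r j)))) Z) \<longlonglongrightarrow> ls_plus_linear A b C Z"
        unfolding ls_plus_linear_def C_def by (intro tendsto_intros lim \<open>Xt \<noteq> 0\<close>)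
      show "\<forall>\<^sub>F j in sequentially. ls_plus_linear A b (lam *\<^sub>R (mat 1 - sgn (X (r j)))) (X (Suc (r j)))
          \<le> ls_plus_linear A b (lam *\<^sub>R (mat 1 - sgn (X (r j)))) Z"
        using opt[OF that] by (simp add: dca_objective_eq)
    qed
    moreover have "hermitian C"
      using hermitian_add[OF hermitian_mat_1 hermitian_scaleR[of Xt "- inverse (norm Xt)"]] psdXt
      unfolding C_def by (intro hermitian_scaleR) (simp add: psd_iff sgn_div_norm)
    ultimately have kkt: "psd (meas_adj A (meas A Xt - b) + C)
        \<and> inner Xt (meas_adj A (meas A Xt - b) + C) = 0"
      using psdXt by (intro minimizer_conic_kkt)
    then have "frob_inner Xt (meas_adj A (meas A Xt - b) + C) = 0"
      using psdXt by (simp add: frob_inner_hermitian psd_iff)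
    moreover have "C = lam *\<^sub>R (mat 1 - (1 / frob_norm Xt) *\<^sub>R Xt)"
      by (simp add: C_def frob_norm_eq_norm sgn_div_norm inverse_eq_divide)
    ultimately show ?thesis
      using kkt psdXt by (simp add: kkt_point_def)
  qed
  with bdd diff0 show ?thesis by blast
qed

end
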